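(* Let $p\ge 1$. Assume that $\mu$ is strictly contracting and almost admits a moment of order $p$. Then there exists $0<a<1$ such that $$\delta_{p,\infty}(n)\le \tilde\delta_{p,\infty}(n)=O(a^n)\qquad (n\to+\infty),$$ and $$\sup_{x,y\in S^+}\ \sup_{n\in\mathbb N}|\sigma(A_n,x)-\sigma(A_n,y)|\in L^p .$$ In particular, $\sup_{n\in\mathbb N}\big|\log\|A_n\|-\log v(A_n)\big|\in L^p$.
   Context: Let $d\ge 2$ be an integer and $\mathbb N=\{1,2,\dots\}$. $\|\cdot\|$ denotes the $\ell^1$ norm on $\mathbb R^d$ and also the associated operator norm $\|g\|=\sup_{\|x\|=1}\|gx\|$ on $d\times d$ matrices. $G$ is the semigroup of $d\times d$ real matrices with nonnegative entries such that every row and every column contains a strictly positive entry, with the topology induced by the norm; $G^+\subset G$ is the set of matrices all of whose entries are strictly positive. $S^+=\{x\in\mathbb R^d:\|x\|=1,\ x_i\ge 0\ \forall i\}$. For $g\in G$, $v(g)=\inf_{x\in S^+}\|gx\|>0$ and $L(g)=\|g\|/v(g)$. For $(g,x)\in G\times S^+$, $g\cdot x=gx/\|gx\|\in S^+$ and $\sigma(g,x)=\log\|gx\|$. $\mu$ is a Borel probability measure on $G$; $\mu^{*r}$ is its $r$-fold convolution (the law of a product of $r$ independent matrices of law $\mu$). $\mu$ is strictly contracting if $\mu^{*r}(G^+)>0$ for some $r\in\mathbb N$. $\mu$ almost admits a moment of order $p\ge1$ if $\int_G(\log L(g))^p\,d\mu(g)<\infty$. $(Y_n)_{n\in\mathbb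 N}$ are iid $G$-valued random variables with law $\mu$, $A_n=Y_n\cdots Y_1$, and $A_0$ is the identity matrix. For $n\in\mathbb N$, $$\delta_{p,\infty}(n)=\sup_{x,y\in S^+}\mathbb E\big(|\sigma(Y_n,A_{n-1}\cdot x)-\sigma(Y_n,A_{n-1}\cdot y)|^p\big),$$ $$\tilde\delta_{p,\infty}(n)=\mathbb E\Big(\sup_{x,y\in S^+}|\sigma(Y_n,A_{n-1}\cdot x)-\sigma(Y_n,A_{n-1}\cdot y)|^p\Big).$$ *)

theory Defs
  imports "HOL-Probability.Probability" "HOL-Library.Landau_Symbols"
begin

(* The type class norm on real ^ 'd is Euclidean, so the l1 norm and its operator norm
   are introduced separately. *)

definition norm_l1 :: "real ^ 'd \<Rightarrow> real" where
  "norm_l1 x = (\<Sum>i\<in>UNIV. \<bar>x $ i\<bar>)"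

definition opnorm_l1 :: "real ^ 'd ^ 'd \<Rightarrow> real" where
  "opnorm_l1 g = (SUP x\<in>{x. norm_l1 x = 1}. norm_l1 (g *v x))"

definition G :: "(real ^ 'd ^ 'd) set" where
  "G = {g. (\<forall>i j. 0 \<le> g $ i $ j) \<and> (\<forall>i. \<exists>j. 0 < g $ i $ j) \<and> (\<forall>j. \<exists>i. 0 < g $ i $ j)}"

definition G_pos :: "(real ^ 'd ^ 'd) set" where
  "G_pos = {g \<in> G. \<forall>i j. 0 < g $ i $ j}"

definition S_plus :: "(real ^ 'd) set" where
  "S_plus = {x. norm_l1 x = 1 \<and> (\<forall>i. 0 \<le> x $ i)}"

definition v :: "real ^ 'd ^ 'd \<Rightarrow> real" where
  "v g = (INF x\<in>S_plus. norm_l1 (g *v x))"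

definition L :: "real ^ 'd ^ 'd \<Rightarrow> real" where
  "L g = opnorm_l1 g / v g"

definition act :: "real ^ 'd ^ 'd \<Rightarrow> real ^ 'd \<Rightarrow> real ^ 'd" (infixr "\<cdot>" 75) where
  "g \<cdot> x = (1 / norm_l1 (g *v x)) *\<^sub>R (g *v x)"

definition \<sigma> :: "real ^ 'd ^ 'd \<Rightarrow> real ^ 'd \<Rightarrow> real" where
  "\<sigma> g x = ln (norm_l1 (g *v x))"

(* All norms on real ^ 'd ^ 'd are equivalent, so this is the Borel sigma-algebra of G for the
   topology induced by opnorm_l1. *)
definition borel_G :: "(real ^ 'd ^ 'd) measure" where
  "borel_G = restrict_space borel G"

(* The convolution of HOL-Probability is additive; here the product is the matrix product. *)
definition mult_convolution ::
    "(real ^ 'd ^ 'd) measure \<Rightarrow> (real ^ 'd ^ 'd) measure \<Rightarrow> (real ^ 'd ^ 'd) measure" where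
  "mult_convolution \<mu> \<nu> = distr (\<mu> \<Otimes>\<^sub>M \<nu>) borel_G (\<lambda>(g, h). g ** h)"

primrec convolution_power :: "(real ^ 'd ^ 'd) measure \<Rightarrow> nat \<Rightarrow> (real ^ 'd ^ 'd) measure" where
  "convolution_power \<mu> 0 = return borel_G (mat 1)"
| "convolution_power \<mu> (Suc r) = mult_convolution \<mu> (convolution_power \<mu> r)"

definition strictly_contracting :: "(real ^ 'd ^ 'd) measure \<Rightarrow> bool" where
  "strictly_contracting \<mu> \<longleftrightarrow> (\<exists>r\<ge>1. emeasure (convolution_power \<mu> r) G_pos > 0)"

definition almost_admits_moment :: "(real ^ 'd ^ 'd) measure \<Rightarrow> real \<Rightarrow> bool" where
  "almost_admits_moment \<mu> p \<longleftrightarrow> (\<integral>\<^sup>+ g. ennreal (ln (L g) powr p) \<partial>\<mu>) < \<infinity>"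

(* Only Y 1, Y 2, ... are used. *)
primrec A :: "(nat \<Rightarrow> 'w \<Rightarrow> real ^ 'd ^ 'd) \<Rightarrow> nat \<Rightarrow> 'w \<Rightarrow> real ^ 'd ^ 'd" where
  "A Y 0 \<omega> = mat 1"
| "A Y (Suc n) \<omega> = Y (Suc n) \<omega> ** A Y n \<omega>"

(* Expectations and suprema are taken in ennreal, so that no default value stands in for an
   infinite one. *)

definition \<delta> :: "'w measure \<Rightarrow> (nat \<Rightarrow> 'w \<Rightarrow> real ^ 'd ^ 'd) \<Rightarrow> real \<Rightarrow> nat \<Rightarrow> ennreal" where
  "\<delta> M Y p n = (SUP x\<in>S_plus. SUP y\<in>S_plus.
     \<integral>\<^sup>+ \<omega>. ennreal (\<bar>\<sigma> (Y n \<omega>) (A Y (n - 1) \<omega> \<cdot> x) - \<sigma> (Y n \<omega>) (A Y (n - 1) \<omega> \<cdot> y)\<bar> powr p) \<partial>M)"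

definition \<delta>_tilde :: "'w measure \<Rightarrow> (nat \<Rightarrow> 'w \<Rightarrow> real ^ 'd ^ 'd) \<Rightarrow> real \<Rightarrow> nat \<Rightarrow> ennreal" where
  "\<delta>_tilde M Y p n = (\<integral>\<^sup>+ \<omega>. (SUP x\<in>S_plus. SUP y\<in>S_plus.
     ennreal (\<bar>\<sigma> (Y n \<omega>) (A Y (n - 1) \<omega> \<cdot> x) - \<sigma> (Y n \<omega>) (A Y (n - 1) \<omega> \<cdot> y)\<bar> powr p)) \<partial>M)"

(* The library has no real powers on ennreal. *)
definition ennreal_powr :: "ennreal \<Rightarrow> real \<Rightarrow> ennreal" where
  "ennreal_powr z p = (if z = \<infinity> then \<infinity> else ennreal (enn2real z powr p))"

definition in_Lp :: "real \<Rightarrow> 'w measure \<Rightarrow> ('w \<Rightarrow> ennreal) \<Rightarrow> bool" where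
  "in_Lp p M f \<longleftrightarrow> f \<in> borel_measurable M \<and> (\<integral>\<^sup>+ \<omega>. ennreal_powr (f \<omega>) p \<partial>M) < \<infinity>"

end

theory Submission
  imports Defs
begin

text \<open>
  The increment \<open>\<sigma> g (h \<cdot> x) - \<sigma> g (h \<cdot> y)\<close> is controlled in two ways. It is at most \<open>ln (L g)\<close>
  in absolute value, whatever \<open>h\<close> is. On the other hand, if \<open>m *\<^sub>R (h *v y) \<le> h *v x \<le> K *\<^sub>R (h *v y)\<close>
  entrywise with \<open>m > 0\<close>, then the norms of \<open>h *v x\<close> and \<open>h *v y\<close>, and those of their images
  under \<open>g\<close>, satisfy the same two inequalities, so that the increment is at most
  \<open>ln (K / m) \<le> (K - m) / m\<close>.

  Such a pair of bounds persists under every matrix of \<open>G\<close>, and a positive matrix improves it. If in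
  each column the ratio of any two entries is at least \<open>\<epsilon>\<close>, the matrix creates bounds with
  \<open>K - m \<le> m / \<epsilon> ^ 4\<close> out of nothing, and it turns given bounds \<open>m, K\<close> into bounds
  \<open>m', K'\<close> with \<open>m' \<ge> m\<close> and \<open>K' - m' = (1 - \<epsilon>\<^sup>2) * (K - m)\<close>. This is Birkhoff's contraction
  in an additive form that needs no projective metric.

  Cut the product \<open>A Y (n - 1)\<close> into blocks of \<open>r\<close> consecutive factors, where \<open>r\<close> and \<open>\<epsilon>\<close> are such
  that a block has the above property with positive probability; strict contraction provides them,
  since \<open>G_pos\<close> is a countable union over \<open>\<epsilon>\<close>. Combining both bounds, the \<open>p\<close>-th power of the
  \<open>n\<close>-th increment is at most \<open>ln (L (Y n)) powr p + C\<close> times a product over the blocks of factors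
  \<open>1 - \<epsilon>\<^sup>2\<close> or \<open>1\<close> (\<open>sigma_increment_powr_le\<close>). These variables are independent, the first has
  finite mean and the others have a common mean \<open>\<theta> < 1\<close>, so \<open>\<delta>_tilde\<close> decays like the powers of
  \<open>a = \<theta> powr (1 / r)\<close> (\<open>ex_geometric_increment_majorant\<close>).

  For \<open>g \<in> G\<close> the numbers \<open>opnorm_l1 g\<close> and \<open>v g\<close> are the largest and the smallest column sum,
  both attained on \<open>S_plus\<close>. Hence the two suprema in the statement agree on \<open>space M\<close>
  (\<open>SUP_sigma_diff_eq\<close>), and the second one is visibly measurable. By the cocycle identity it is
  bounded by the sum of uniform bounds for the increments, and the convexity of
  \<open>\<lambda>t. t powr p\<close>, used with geometric weights, bounds the \<open>p\<close>-th power of that sum by an integrable series.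
\<close>

section \<open>Column sums, operator norm and minimal expansion\<close>

text \<open>
  The sum of the entries of column \<open>j\<close>. For a nonnegative matrix \<open>g\<close> and a nonnegative vector \<open>x\<close>,
  the norm of \<open>g *v x\<close> depends on \<open>g\<close> only through its column sums.
\<close>

definition col_sum :: "real ^ 'd ^ 'd \<Rightarrow> 'd \<Rightarrow> real" where
  "col_sum g j = (\<Sum>i\<in>UNIV. g $ i $ j)"

lemma norm_l1_mult_nonneg:
  assumes "\<And>i j. 0 \<le> g $ i $ j" "\<And>j. 0 \<le> x $ j"
  shows "norm_l1 (g *v x) = (\<Sum>j\<in>UNIV. col_sum g j * x $ j)"
proof -
  have "norm_l1 (g *v x) = (\<Sum>i\<in>UNIV. \<Sum>j\<in>UNIV. g $ i $ j * x $ j)"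
    unfolding norm_l1_def matrix_vector_mult_def
    using assms by (auto intro!: sum.cong abs_of_nonneg sum_nonneg mult_nonneg_nonneg)
  also have "\<dots> = (\<Sum>j\<in>UNIV. col_sum g j * x $ j)"
    by (subst sum.swap) (simp add: col_sum_def sum_distrib_right)
  finally show ?thesis .
qed

lemma norm_l1_mult_le:
  assumes "\<And>i j. 0 \<le> g $ i $ j"
  shows "norm_l1 (g *v x) \<le> (\<Sum>j\<in>UNIV. col_sum g j * \<bar>x $ j\<bar>)"
proof -
  have "norm_l1 (g *v x) \<le> (\<Sum>i\<in>UNIV. \<Sum>j\<in>UNIV. g $ i $ j * \<bar>x $ j\<bar>)"
    unfolding norm_l1_def matrix_vector_mult_def
    using assms by (auto intro!: sum_mono order_trans[OF sum_abs] simp: abs_mult)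
  also have "\<dots> = (\<Sum>j\<in>UNIV. col_sum g j * \<bar>x $ j\<bar>)"
    by (subst sum.swap) (simp add: col_sum_def sum_distrib_right)
  finally show ?thesis .
qed

lemma G_nonneg: "g \<in> G \<Longrightarrow> 0 \<le> g $ i $ j"
  by (simp add: G_def)

lemma col_sum_pos: "g \<in> G \<Longrightarrow> 0 < col_sum g j"
proof -
  assume g: "g \<in> G"
  then obtain i where "0 < g $ i $ j"
    unfolding G_def by blast
  with g show ?thesis
    unfolding col_sum_def by (intro sum_pos2[where i = i]) (simp_all add: G_nonneg)
qed

lemma axis_in_S_plus: "axis j 1 \<in> S_plus"
  by (simp add: S_plus_def norm_l1_def axis_def if_distrib cong: if_cong)

lemma norm_l1_mult_axis: "g \<in> G \<Longrightarrow> norm_l1 (g *v axis j 1) = col_sum g j"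
  by (subst norm_l1_mult_nonneg) (auto simp: G_nonneg axis_def if_distrib cong: if_cong)

lemma norm_l1_mult_ge_Min:
  assumes "g \<in> G" "x \<in> S_plus"
  shows "Min (range (col_sum g)) \<le> norm_l1 (g *v x)"
proof -
  have x: "\<And>j. 0 \<le> x $ j" "(\<Sum>j\<in>UNIV. x $ j) = 1"
    using assms(2) by (auto simp: S_plus_def norm_l1_def)
  have "Min (range (col_sum g)) = (\<Sum>j\<in>UNIV. Min (range (col_sum g)) * x $ j)"
    by (simp add: x sum_distrib_left[symmetric])
  also have "\<dots> \<le> (\<Sum>j\<in>UNIV. col_sum g j * x $ j)"
    by (intro sum_mono mult_right_mono x) simp
  finally show ?thesis
    using norm_l1_mult_nonneg[of g x] assms x by (simp add: G_nonneg)
qed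

lemma norm_l1_mult_le_Max:
  assumes "g \<in> G" "norm_l1 x = 1"
  shows "norm_l1 (g *v x) \<le> Max (range (col_sum g))"
proof -
  have "norm_l1 (g *v x) \<le> (\<Sum>j\<in>UNIV. col_sum g j * \<bar>x $ j\<bar>)"
    using assms by (intro norm_l1_mult_le) (simp add: G_nonneg)
  also have "\<dots> \<le> (\<Sum>j\<in>UNIV. Max (range (col_sum g)) * \<bar>x $ j\<bar>)"
    by (intro sum_mono mult_right_mono) auto
  also have "\<dots> = Max (range (col_sum g))"
    using assms(2) by (simp add: norm_l1_def sum_distrib_left[symmetric])
  finally show ?thesis .
qed

lemma opnorm_l1_eq_Max:
  assumes "g \<in> G"
  shows "opnorm_l1 g = Max (range (col_sum g))"
proof -
  have "Max (range (col_sum g)) \<in> range (col_sum g)"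
    by (intro Max_in) auto
  then obtain j where j: "Max (range (col_sum g)) = col_sum g j"
    by (rule rangeE)
  have "axis j 1 \<in> {x :: real ^ 'a. norm_l1 x = 1}"
    using axis_in_S_plus[of j] by (simp add: S_plus_def)
  then show ?thesis
    unfolding opnorm_l1_def using assms
    by (intro cSup_eq_maximum)
       (auto intro!: image_eqI[where x = "axis j 1"] simp: norm_l1_mult_axis norm_l1_mult_le_Max[of g, simplified j] j)
qed

lemma v_eq_Min:
  assumes "g \<in> G"
  shows "v g = Min (range (col_sum g))"
proof -
  have "Min (range (col_sum g)) \<in> range (col_sum g)"
    by (intro Min_in) auto
  then obtain j where j: "Min (range (col_sum g)) = col_sum g j"
    by (rule rangeE)
  with assms show ?thesis
    unfolding v_def
    by (intro cInf_eq_minimum)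
       (auto intro!: image_eqI[where x = "axis j 1"] axis_in_S_plus
         simp: norm_l1_mult_axis norm_l1_mult_ge_Min[of g, simplified j] j)
qed

lemma v_attained:
  assumes "g \<in> G"
  obtains x where "x \<in> S_plus" "norm_l1 (g *v x) = v g"
proof -
  have "Min (range (col_sum g)) \<in> range (col_sum g)"
    by (intro Min_in) auto
  then obtain j where "Min (range (col_sum g)) = col_sum g j"
    by (rule rangeE)
  with that[OF axis_in_S_plus] assms show thesis
    by (simp add: v_eq_Min norm_l1_mult_axis)
qed

lemma opnorm_l1_attained:
  assumes "g \<in> G"
  obtains x where "x \<in> S_plus" "norm_l1 (g *v x) = opnorm_l1 g"
proof -
  have "Max (range (col_sum g)) \<in> range (col_sum g)"
    by (intro Max_in) auto
  then obtain j where "Max (range (col_sum g)) = col_sum g j"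
    by (rule rangeE)
  with that[OF axis_in_S_plus] assms show thesis
    by (simp add: opnorm_l1_eq_Max norm_l1_mult_axis)
qed

lemma v_pos: "g \<in> G \<Longrightarrow> 0 < v g"
  by (simp add: v_eq_Min col_sum_pos)

lemma norm_l1_mult_bounds:
  assumes "g \<in> G" "x \<in> S_plus"
  shows "v g \<le> norm_l1 (g *v x)" "norm_l1 (g *v x) \<le> opnorm_l1 g"
  using norm_l1_mult_ge_Min[OF assms] norm_l1_mult_le_Max[of g x] assms
  by (auto simp: v_eq_Min opnorm_l1_eq_Max S_plus_def)

lemma opnorm_l1_pos: "g \<in> G \<Longrightarrow> 0 < opnorm_l1 g"
  using norm_l1_mult_bounds[OF _ axis_in_S_plus] v_pos by (meson less_le_trans)

lemma ln_L_eq: "g \<in> G \<Longrightarrow> ln (L g) = ln (opnorm_l1 g) - ln (v g)"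
  using v_pos[of g] opnorm_l1_pos[of g] by (simp add: L_def ln_div)

lemma abs_sigma_diff_le:
  assumes "g \<in> G" "x \<in> S_plus" "y \<in> S_plus"
  shows "\<bar>\<sigma> g x - \<sigma> g y\<bar> \<le> ln (L g)"
proof -
  have "ln (v g) \<le> \<sigma> g z \<and> \<sigma> g z \<le> ln (opnorm_l1 g)" if "z \<in> S_plus" for z
    using norm_l1_mult_bounds[OF assms(1) that] v_pos[OF assms(1)]
    by (simp add: \<sigma>_def ln_mono)
  from this[OF assms(2)] this[OF assms(3)] show ?thesis
    by (simp add: ln_L_eq assms(1) abs_le_iff)
qed

section \<open>The semigroup and its action on the simplex\<close>

lemma G_mult:
  assumes "g \<in> G" "h \<in> G"
  shows "g ** h \<in> G"
proof -
  have nn: "0 \<le> (g ** h) $ i $ j" for i j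
    using assms by (auto simp: matrix_matrix_mult_def G_nonneg intro!: sum_nonneg)
  have pos: "0 < (g ** h) $ i $ j" if "0 < g $ i $ k" "0 < h $ k $ j" for i j k
    unfolding matrix_matrix_mult_def using that assms
    by (auto intro!: sum_pos2[where i = k] simp: G_nonneg)
  have "\<exists>j. 0 < (g ** h) $ i $ j" "\<exists>j. 0 < (g ** h) $ j $ i" for i
  proof -
    obtain k j where "0 < g $ i $ k" "0 < h $ k $ j"
      using assms unfolding G_def by blast
    then show "\<exists>j. 0 < (g ** h) $ i $ j"
      using pos by blast
    obtain k j where "0 < h $ k $ i" "0 < g $ j $ k"
      using assms unfolding G_def by blast
    then show "\<exists>j. 0 < (g ** h) $ j $ i"
      using pos by blast
  qed
  with nn show ?thesis
    unfolding G_def by blast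
qed

lemma mat_1_in_G: "mat 1 \<in> G"
  by (auto simp: G_def mat_def)

lemma A_in_G:
  assumes "\<And>k. k \<ge> 1 \<Longrightarrow> Y k \<omega> \<in> G"
  shows "A Y n \<omega> \<in> G"
  using assms by (induction n) (auto simp: mat_1_in_G G_mult)

lemma norm_l1_mult_pos: "g \<in> G \<Longrightarrow> x \<in> S_plus \<Longrightarrow> 0 < norm_l1 (g *v x)"
  using norm_l1_mult_bounds(1)[of g x] v_pos[of g] by linarith

lemma norm_l1_scaleR: "norm_l1 (c *\<^sub>R x) = \<bar>c\<bar> * norm_l1 x"
  by (simp add: norm_l1_def abs_mult sum_distrib_left)

lemma mult_vec_nonneg:
  fixes g :: "real ^ 'n ^ 'm"
  assumes "\<And>i j. 0 \<le> g $ i $ j" "\<And>j. 0 \<le> x $ j"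
  shows "0 \<le> (g *v x) $ i"
  using assms by (auto simp: matrix_vector_mult_def intro!: sum_nonneg mult_nonneg_nonneg)

lemma act_in_S_plus:
  assumes "g \<in> G" "x \<in> S_plus"
  shows "act g x \<in> S_plus"
proof -
  have "\<And>i. 0 \<le> (g *v x) $ i"
    using assms by (intro mult_vec_nonneg) (auto simp: G_nonneg S_plus_def)
  then show ?thesis
    using norm_l1_mult_pos[OF assms] by (auto simp: S_plus_def act_def norm_l1_scaleR)
qed

lemma mult_scaleR_vec: "g *v (c *\<^sub>R x) = c *\<^sub>R (g *v (x :: real ^ 'd))"
  by (simp add: vec_eq_iff matrix_vector_mult_def sum_distrib_left mult.left_commute)

text \<open>
  The cocycle identity. It turns \<open>\<sigma> (A Y n \<omega>) x\<close> into a sum of one-step terms.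
\<close>

lemma sigma_act:
  assumes "g \<in> G" "h \<in> G" "x \<in> S_plus"
  shows "\<sigma> g (act h x) = \<sigma> (g ** h) x - \<sigma> h x"
proof -
  have "0 < norm_l1 (h *v x)" "0 < norm_l1 ((g ** h) *v x)"
    using assms by (simp_all add: norm_l1_mult_pos G_mult)
  then show ?thesis
    by (simp add: \<sigma>_def act_def norm_l1_scaleR ln_div
        matrix_vector_mul_assoc[symmetric] mult_scaleR_vec)
qed

section \<open>Contraction by matrices with comparable rows\<close>

text \<open>
  Entrywise comparison of two vectors, stated without quotients so that entries of \<open>y\<close> may vanish.
  For \<open>m > 0\<close>, the logarithm of \<open>K / m\<close> bounds the Hilbert projective distance of
  nonzero nonnegative \<open>x\<close> and \<open>y\<close>.
\<close>

definition squeezed :: "real \<Rightarrow> real \<Rightarrow> real ^ 'd \<Rightarrow> real ^ 'd \<Rightarrow> bool" where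
  "squeezed m K x y \<longleftrightarrow> (\<forall>i. m * y $ i \<le> x $ i \<and> x $ i \<le> K * y $ i)"

text \<open>
  Positive matrices in which any entry is at least \<open>\<epsilon>\<close> times every entry of the same column.
\<close>

definition pinched :: "real \<Rightarrow> real ^ 'd ^ 'd \<Rightarrow> bool" where
  "pinched \<epsilon> g \<longleftrightarrow> (\<forall>i j k. 0 < g $ i $ j \<and> \<epsilon> * g $ k $ j \<le> g $ i $ j)"

lemma squeezed_iff: "squeezed m K x y \<longleftrightarrow> (\<forall>i. 0 \<le> (x - m *\<^sub>R y) $ i \<and> 0 \<le> (K *\<^sub>R y - x) $ i)"
  by (auto simp: squeezed_def)

lemma squeezed_mult:
  assumes "squeezed m K x y" "\<And>i j. 0 \<le> g $ i $ j"
  shows "squeezed m K (g *v x) (g *v y)"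
proof -
  have "0 \<le> (g *v (x - m *\<^sub>R y)) $ i \<and> 0 \<le> (g *v (K *\<^sub>R y - x)) $ i" for i
    using assms by (auto simp: squeezed_iff intro!: mult_vec_nonneg)
  then show ?thesis
    by (simp add: squeezed_iff matrix_vector_mult_diff_distrib mult_scaleR_vec)
qed

lemma pinched_mult_vec:
  assumes "pinched \<epsilon> g" "\<And>j. 0 \<le> x $ j"
  shows "\<epsilon> * (g *v x) $ k \<le> (g *v x) $ i"
  unfolding matrix_vector_mult_def
  using assms by (auto simp: sum_distrib_left pinched_def mult.assoc[symmetric]
      intro!: sum_mono mult_right_mono)

lemma pinched_mult_pos:
  assumes "pinched \<epsilon> g" "\<And>j. 0 \<le> x $ j" "x \<noteq> 0"
  shows "0 < (g *v x) $ i"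
proof -
  obtain j where "x $ j \<noteq> 0"
    using assms(3) by (auto simp: vec_eq_iff)
  then have "0 < x $ j"
    using assms(2)[of j] by simp
  moreover have "0 < g $ i $ j" for i j
    using assms(1) by (simp add: pinched_def)
  ultimately show ?thesis
    unfolding matrix_vector_mult_def vec_lambda_beta using assms(2)
    by (intro sum_pos2[where i = j]) (simp_all add: less_imp_le)
qed

text \<open>
  A lower bound for the ratio of \<open>g *v u\<close> to \<open>g *v y\<close> at every index \<open>i\<close> in terms of the ratio at a
  single index \<open>k\<close>. It is applied to \<open>x - m *\<^sub>R y\<close> and \<open>K *\<^sub>R y - x\<close>, whose ratios at \<open>k\<close> add up
  to \<open>K - m\<close>.
\<close>

lemma pinched_lower:
  assumes "pinched \<epsilon> g" "0 < \<epsilon>" "\<And>j. 0 \<le> u $ j" "\<And>j. 0 \<le> y $ j" "y \<noteq> 0"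
  shows "\<epsilon>\<^sup>2 * ((g *v u) $ k / (g *v y) $ k) * (g *v y) $ i \<le> (g *v u) $ i"
proof -
  have pos: "0 < (g *v y) $ k"
    using assms by (intro pinched_mult_pos)
  have t: "0 \<le> (g *v u) $ k / (g *v y) $ k"
    using pinched_mult_pos[of \<epsilon> g u k] assms pos by (cases "u = 0") (auto simp: less_imp_le)
  have "\<epsilon>\<^sup>2 * ((g *v u) $ k / (g *v y) $ k) * (g *v y) $ i
      = \<epsilon> * ((g *v u) $ k / (g *v y) $ k) * (\<epsilon> * (g *v y) $ i)"
    by (simp add: power2_eq_square)
  also have "\<dots> \<le> \<epsilon> * ((g *v u) $ k / (g *v y) $ k) * (g *v y) $ k"
    using assms t by (intro mult_left_mono pinched_mult_vec mult_nonneg_nonneg) auto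
  also have "\<dots> = \<epsilon> * (g *v u) $ k"
    using pos by simp
  also have "\<dots> \<le> (g *v u) $ i"
    using assms by (intro pinched_mult_vec)
  finally show ?thesis .
qed

lemma pinched_contracts:
  assumes "pinched \<epsilon> g" "0 < \<epsilon>" "squeezed m K x y" "\<And>j. 0 \<le> y $ j" "y \<noteq> 0"
  obtains m' K' where "squeezed m' K' (g *v x) (g *v y)" "m \<le> m'"
    "K' - m' = (1 - \<epsilon>\<^sup>2) * (K - m)"
proof -
  fix k :: 'a
  \<comment> \<open>The index \<open>k\<close> is arbitrary; \<open>m\<close> rises by \<open>\<epsilon>\<^sup>2 * s\<close> and \<open>K\<close> falls by \<open>\<epsilon>\<^sup>2 * t\<close>, with \<open>s + t = K - m\<close>.\<close>
  define s where "s = (g *v (x - m *\<^sub>R y)) $ k / (g *v y) $ k"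
  define t where "t = (g *v (K *\<^sub>R y - x)) $ k / (g *v y) $ k"
  have pos: "0 < (g *v y) $ k"
    using assms by (intro pinched_mult_pos)
  have nn: "0 \<le> (x - m *\<^sub>R y) $ i" "0 \<le> (K *\<^sub>R y - x) $ i" for i
    using assms(3) by (auto simp: squeezed_iff)
  have s: "0 \<le> s"
    unfolding s_def using pos assms(1) nn
    by (intro divide_nonneg_pos mult_vec_nonneg) (auto simp: pinched_def less_imp_le)
  have "s + t = K - m"
    using pos unfolding s_def t_def
    by (simp add: matrix_vector_mult_diff_distrib mult_scaleR_vec field_simps)
  then have eq: "(K - \<epsilon>\<^sup>2 * t) - (m + \<epsilon>\<^sup>2 * s) = (1 - \<epsilon>\<^sup>2) * (K - m)"
    by algebra
  have "squeezed (m + \<epsilon>\<^sup>2 * s) (K - \<epsilon>\<^sup>2 * t) (g *v x) (g *v y)"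
    unfolding squeezed_def
  proof (intro allI)
    fix i
    show "(m + \<epsilon>\<^sup>2 * s) * (g *v y) $ i \<le> (g *v x) $ i \<and>
        (g *v x) $ i \<le> (K - \<epsilon>\<^sup>2 * t) * (g *v y) $ i"
      using pinched_lower[OF assms(1,2) nn(1) assms(4,5), of k i]
        pinched_lower[OF assms(1,2) nn(2) assms(4,5), of k i]
      unfolding s_def[symmetric] t_def[symmetric]
      by (simp add: matrix_vector_mult_diff_distrib mult_scaleR_vec algebra_simps)
  qed
  with that[OF this _ eq] s show thesis
    by simp
qed

text \<open>
  No prior comparison of \<open>x\<close> and \<open>y\<close> is needed: they may even have disjoint supports.
\<close>

lemma pinched_squeezes:
  assumes "pinched \<epsilon> g" "0 < \<epsilon>" "\<And>j. 0 \<le> x $ j" "x \<noteq> 0" "\<And>j. 0 \<le> y $ j" "y \<noteq> 0"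
  obtains m K where "squeezed m K (g *v x) (g *v y)" "0 < m" "K - m \<le> m / \<epsilon> ^ 4"
proof -
  fix k :: 'a
  define t where "t = (g *v x) $ k / (g *v y) $ k"
  have pos: "0 < (g *v y) $ k" "0 < (g *v x) $ k"
    using assms by (auto intro!: pinched_mult_pos)
  then have t: "0 < t"
    by (simp add: t_def)
  have "squeezed (\<epsilon>\<^sup>2 * t) (t / \<epsilon>\<^sup>2) (g *v x) (g *v y)"
    unfolding squeezed_def
  proof (intro allI)
    fix i
    \<comment> \<open>The upper bound is the lower bound with the roles of \<open>x\<close> and \<open>y\<close> exchanged.\<close>
    have "\<epsilon>\<^sup>2 * (1 / t) * (g *v x) $ i \<le> (g *v y) $ i"
      using pinched_lower[OF assms(1,2,5,3,4), of k i] by (simp add: t_def)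
    with pinched_lower[OF assms(1,2,3,5,6), of k i] t \<open>0 < \<epsilon>\<close>
    show "\<epsilon>\<^sup>2 * t * (g *v y) $ i \<le> (g *v x) $ i \<and> (g *v x) $ i \<le> t / \<epsilon>\<^sup>2 * (g *v y) $ i"
      by (simp add: t_def[symmetric] field_simps)
  qed
  moreover have "t / \<epsilon>\<^sup>2 - \<epsilon>\<^sup>2 * t \<le> (\<epsilon>\<^sup>2 * t) / \<epsilon> ^ 4"
    using t assms(2) by (simp add: field_simps power2_eq_square power4_eq_xxxx)
  ultimately show thesis
    using that[of "\<epsilon>\<^sup>2 * t"] t assms(2) by simp
qed

lemma squeezed_norm_l1:
  assumes "squeezed m K x y" "0 < m" "\<And>j. 0 \<le> y $ j"
  shows "m * norm_l1 y \<le> norm_l1 x" "norm_l1 x \<le> K * norm_l1 y"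
proof -
  have "0 \<le> x $ j" for j
    using assms by (metis squeezed_def mult_nonneg_nonneg less_imp_le order_trans)
  then show "m * norm_l1 y \<le> norm_l1 x" "norm_l1 x \<le> K * norm_l1 y"
    using assms by (auto simp: squeezed_def norm_l1_def sum_distrib_left intro!: sum_mono)
qed

text \<open>
  Applying \<open>g\<close> and normalising both preserve the ratio \<open>K / m\<close>, so \<open>ln (K / m)\<close> bounds the difference;
  \<open>ln t \<le> t - 1\<close> makes the bound linear in \<open>K - m\<close>.
\<close>

lemma sigma_diff_squeezed:
  assumes "g \<in> G" "h \<in> G" "x \<in> S_plus" "y \<in> S_plus"
    and "squeezed m K (h *v x) (h *v y)" "0 < m"
  shows "\<bar>\<sigma> g (act h x) - \<sigma> g (act h y)\<bar> \<le> (K - m) / m"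
proof -
  have nn: "0 \<le> (h *v y) $ j" for j
    using assms(2,4) by (intro mult_vec_nonneg) (auto simp: G_nonneg S_plus_def)
  have nn': "0 \<le> (g *v (h *v y)) $ j" for j
    by (rule mult_vec_nonneg[OF G_nonneg[OF assms(1)] nn])
  have hy: "0 < norm_l1 (h *v y)" and hx: "0 < norm_l1 (h *v x)"
    and gy: "0 < norm_l1 ((g ** h) *v y)" and gx: "0 < norm_l1 ((g ** h) *v x)"
    using assms by (simp_all add: norm_l1_mult_pos G_mult)
  have 1: "m * norm_l1 (h *v y) \<le> norm_l1 (h *v x)" "norm_l1 (h *v x) \<le> K * norm_l1 (h *v y)"
    using squeezed_norm_l1[OF assms(5,6) nn] .
  then have K: "0 < K"
    using hx hy by (meson less_le_trans zero_less_mult_pos2)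
  have "squeezed m K (g *v (h *v x)) (g *v (h *v y))"
    by (rule squeezed_mult[OF assms(5) G_nonneg[OF assms(1)]])
  from squeezed_norm_l1[OF this assms(6) nn']
  have 2: "m * norm_l1 ((g ** h) *v y) \<le> norm_l1 ((g ** h) *v x)"
    "norm_l1 ((g ** h) *v x) \<le> K * norm_l1 ((g ** h) *v y)"
    by (simp_all add: matrix_vector_mul_assoc)
  have ln2: "ln m + ln b \<le> ln a \<and> ln a \<le> ln K + ln b"
    if "m * b \<le> a" "a \<le> K * b" "0 < a" "0 < b" for a b :: real
  proof -
    have "ln (m * b) \<le> ln a" "ln a \<le> ln (K * b)"
      using that K assms(6) by (auto intro!: ln_mono mult_pos_pos)
    then show ?thesis
      using that K assms(6) by (simp add: ln_mult)
  qed
  have "\<bar>\<sigma> g (act h x) - \<sigma> g (act h y)\<bar> \<le> ln K - ln m"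
    using ln2[OF 1 hx hy] ln2[OF 2 gx gy] sigma_act[OF assms(1,2,3)] sigma_act[OF assms(1,2,4)]
    unfolding \<sigma>_def by linarith
  also have "\<dots> = ln (K / m)"
    using K assms(6) by (simp add: ln_div)
  also have "\<dots> \<le> K / m - 1"
    using K assms(6) by (intro ln_le_minus_one) simp
  also have "\<dots> = (K - m) / m"
    using assms(6) by (simp add: field_simps)
  finally show ?thesis .
qed

section \<open>Products cut into blocks\<close>

lemma A_add: "A Y (s + r) \<omega> = A (\<lambda>k. Y (s + k)) r \<omega> ** A Y s \<omega>"
  by (induction r) (auto simp: matrix_mul_assoc)

text \<open>
  The factor by which \<open>g\<close> is certain to shrink the gap \<open>K - m\<close>.
\<close>

definition factor :: "real \<Rightarrow> real ^ 'd ^ 'd \<Rightarrow> real" where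
  "factor \<epsilon> g = (if pinched \<epsilon> g then 1 - \<epsilon>\<^sup>2 else 1)"

lemma factor_bounds:
  assumes "0 < \<epsilon>" "\<epsilon> < 1"
  shows "1 - \<epsilon>\<^sup>2 \<le> factor \<epsilon> g" "factor \<epsilon> g \<le> 1" "0 < factor \<epsilon> g"
proof -
  have "\<epsilon>\<^sup>2 < 1"
    using assms by (simp add: power_less_one_iff)
  then show "1 - \<epsilon>\<^sup>2 \<le> factor \<epsilon> g" "factor \<epsilon> g \<le> 1" "0 < factor \<epsilon> g"
    by (auto simp: factor_def)
qed

text \<open>
  The product of the \<open>r\<close> matrices with indices \<open>j * r + 1, \<dots>, j * r + r\<close>, later factors on the left.
  Blocks are numbered from \<open>0\<close>.
\<close>

definition block :: "(nat \<Rightarrow> 'w \<Rightarrow> real ^ 'd ^ 'd) \<Rightarrow> nat \<Rightarrow> nat \<Rightarrow> 'w \<Rightarrow> real ^ 'd ^ 'd" where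
  "block Y r j = A (\<lambda>k. Y (j * r + k)) r"

lemma A_block: "A Y (Suc q * r) \<omega> = block Y r q \<omega> ** A Y (q * r) \<omega>"
  unfolding block_def by (metis A_add add.commute mult_Suc)

lemma block_in_G:
  assumes "\<And>k. k \<ge> 1 \<Longrightarrow> Y k \<omega> \<in> G"
  shows "block Y r j \<omega> \<in> G"
  unfolding block_def using assms by (intro A_in_G) auto

text \<open>
  The product of the factors equals \<open>1\<close> exactly when no block is pinched, the only case in which no
  comparison is available. The first pinched block gives \<open>K - m \<le> m / \<epsilon> ^ 4\<close> but also counts as a
  factor \<open>1 - \<epsilon>\<^sup>2\<close>, whence the inverse of \<open>1 - \<epsilon>\<^sup>2\<close> in the constant.
\<close>

lemma squeezed_blocks:
  assumes \<epsilon>: "0 < \<epsilon>" "\<epsilon> < 1" and Y: "\<And>k. k \<ge> 1 \<Longrightarrow> Y k \<omega> \<in> G"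
    and xy: "x \<in> S_plus" "y \<in> S_plus"
  shows "(\<Prod>j<q. factor \<epsilon> (block Y r j \<omega>)) = 1 \<or>
    (\<exists>m K. 0 < m \<and> squeezed m K (A Y (q * r) \<omega> *v x) (A Y (q * r) \<omega> *v y) \<and>
      K - m \<le> (\<Prod>j<q. factor \<epsilon> (block Y r j \<omega>)) / ((1 - \<epsilon>\<^sup>2) * \<epsilon> ^ 4) * m)"
proof (induction q)
  case 0
  then show ?case by simp
next
  case (Suc q)
  define P where "P = (\<Prod>j<q. factor \<epsilon> (block Y r j \<omega>))"
  define C where "C = 1 / ((1 - \<epsilon>\<^sup>2) * \<epsilon> ^ 4)"
  define x' where "x' = A Y (q * r) \<omega> *v x"
  define y' where "y' = A Y (q * r) \<omega> *v y"
  define B where "B = block Y r q \<omega>"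
  have e: "0 < 1 - \<epsilon>\<^sup>2"
    using \<epsilon> by (simp add: power_less_one_iff)
  have P: "0 < P"
    unfolding P_def using factor_bounds[OF \<epsilon>] by (intro prod_pos) auto
  have AG: "A Y (q * r) \<omega> \<in> G" and BG: "B \<in> G"
    using Y by (auto simp: B_def intro: A_in_G block_in_G)
  have nn: "0 \<le> x' $ j" "0 \<le> y' $ j" for j
    using AG xy by (auto simp: x'_def y'_def S_plus_def G_nonneg intro!: mult_vec_nonneg)
  have "norm_l1 (0 :: real ^ 'a) = 0"
    by (simp add: norm_l1_def)
  then have nz: "x' \<noteq> 0" "y' \<noteq> 0"
    using norm_l1_mult_pos[OF AG xy(1)] norm_l1_mult_pos[OF AG xy(2)]
    by (auto simp: x'_def y'_def)
  have step: "A Y (Suc q * r) \<omega> *v x = B *v x'" "A Y (Suc q * r) \<omega> *v y = B *v y'"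
    unfolding A_block B_def x'_def y'_def by (simp_all add: matrix_vector_mul_assoc)
  have IH: "P = 1 \<or> (\<exists>m K. 0 < m \<and> squeezed m K x' y' \<and> K - m \<le> P * C * m)"
    using Suc by (simp add: P_def C_def x'_def y'_def)
  have "P * factor \<epsilon> B = 1 \<or>
      (\<exists>m K. 0 < m \<and> squeezed m K (B *v x') (B *v y') \<and> K - m \<le> P * factor \<epsilon> B * C * m)"
  proof (cases "pinched \<epsilon> B")
    case pin: True
    then have fac: "factor \<epsilon> B = 1 - \<epsilon>\<^sup>2"
      by (simp add: factor_def)
    show ?thesis
    proof (cases "P = 1")
      case True
      obtain m K where mK: "squeezed m K (B *v x') (B *v y')" "0 < m" "K - m \<le> m / \<epsilon> ^ 4"
        using pinched_squeezes[OF pin \<epsilon>(1) nn(1) nz(1) nn(2) nz(2)] .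
      moreover have "P * factor \<epsilon> B * C * m = m / \<epsilon> ^ 4"
        using e True by (simp add: fac C_def)
      ultimately show ?thesis
        by force
    next
      case False
      then obtain m K where mK: "0 < m" "squeezed m K x' y'" "K - m \<le> P * C * m"
        using IH by blast
      obtain m' K' where mK': "squeezed m' K' (B *v x') (B *v y')" "m \<le> m'"
        "K' - m' = (1 - \<epsilon>\<^sup>2) * (K - m)"
        using pinched_contracts[OF pin \<epsilon>(1) mK(2) nn(2) nz(2)] .
      have "K - m \<le> P * C * m'"
        using mK(3) mK'(2) P e by (elim order_trans, intro mult_left_mono) (auto simp: C_def)
      then have "(1 - \<epsilon>\<^sup>2) * (K - m) \<le> (1 - \<epsilon>\<^sup>2) * (P * C * m')"
        using e by (intro mult_left_mono) auto
      then have "K' - m' \<le> P * factor \<epsilon> B * C * m'"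
        unfolding mK'(3) fac by (simp add: ac_simps)
      with mK' mK(1) show ?thesis
        by (meson less_le_trans)
    qed
  next
    case False
    then have "factor \<epsilon> B = 1"
      by (simp add: factor_def)
    with IH show ?thesis
      using squeezed_mult[of _ _ x' y' B] BG by (auto simp: G_nonneg)
  qed
  then show ?case
    unfolding step by (simp add: P_def B_def C_def)
qed

text \<open>
  Both bounds for the increment in one. The matrices with indices from \<open>q * r + 1\<close> to \<open>n - 1\<close>,
  which follow the \<open>q\<close> blocks, do no harm.
\<close>

lemma sigma_increment_powr_le:
  assumes \<epsilon>: "0 < \<epsilon>" "\<epsilon> < 1" and Y: "\<And>k. k \<ge> 1 \<Longrightarrow> Y k \<omega> \<in> G"
    and xy: "x \<in> S_plus" "y \<in> S_plus" and p: "1 \<le> p" and n: "1 \<le> n" "q * r \<le> n - 1"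
  shows "\<bar>\<sigma> (Y n \<omega>) (act (A Y (n - 1) \<omega>) x) - \<sigma> (Y n \<omega>) (act (A Y (n - 1) \<omega>) y)\<bar> powr p
    \<le> (ln (L (Y n \<omega>)) powr p + (1 / ((1 - \<epsilon>\<^sup>2) * \<epsilon> ^ 4)) powr p)
       * (\<Prod>j<q. factor \<epsilon> (block Y r j \<omega>))" (is "?d powr p \<le> (?W + ?C powr p) * ?P")
proof -
  have e: "0 < 1 - \<epsilon>\<^sup>2"
    using \<epsilon> by (simp add: power_less_one_iff)
  have P: "0 < ?P" "?P \<le> 1"
    using factor_bounds[OF \<epsilon>] by (auto intro!: prod_pos prod_le_1 conjI less_imp_le[OF factor_bounds(3)[OF \<epsilon>]])
  have AG: "A Y (n - 1) \<omega> \<in> G" and YG: "Y n \<omega> \<in> G"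
    using Y n by (auto intro: A_in_G)
  show ?thesis
  proof (cases "?P = 1")
    case True
    have "?d \<le> ln (L (Y n \<omega>))"
      using AG YG xy by (intro abs_sigma_diff_le act_in_S_plus)
    then have "?d powr p \<le> ?W"
      using p by (intro powr_mono2) auto
    with True show ?thesis
      by (simp add: add_increasing2)
  next
    case False
    then obtain m K where 2: "0 < m" "K - m \<le> ?P / ((1 - \<epsilon>\<^sup>2) * \<epsilon> ^ 4) * m"
      "squeezed m K (A Y (q * r) \<omega> *v x) (A Y (q * r) \<omega> *v y)"
      using squeezed_blocks[where q = q and r = r and Y = Y and \<omega> = \<omega>, OF \<epsilon> Y xy] by metis
    define h where "h = A (\<lambda>k. Y (q * r + k)) (n - 1 - q * r) \<omega>"
    have h: "h \<in> G" "A Y (n - 1) \<omega> = h ** A Y (q * r) \<omega>"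
      using Y n A_add[of Y "q * r" "n - 1 - q * r" \<omega>] by (auto simp: h_def intro!: A_in_G)
    have "squeezed m K (A Y (n - 1) \<omega> *v x) (A Y (n - 1) \<omega> *v y)"
      unfolding h(2) matrix_vector_mul_assoc[symmetric]
      by (rule squeezed_mult[OF 2(3) G_nonneg[OF h(1)]])
    then have "?d \<le> (K - m) / m"
      using sigma_diff_squeezed YG AG xy 2 by blast
    also have "\<dots> \<le> ?C * ?P"
      using 2 by (simp add: field_simps)
    finally have "?d powr p \<le> (?C * ?P) powr p"
      using p by (intro powr_mono2) auto
    also have "\<dots> = ?C powr p * ?P powr p"
      by (rule powr_mult)
    \<comment> \<open>As \<open>?P \<le> 1\<close>, the exponent \<open>p \<ge> 1\<close> may be dropped; this keeps the bound a product.\<close>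
    also have "\<dots> \<le> ?C powr p * ?P"
      using P p powr_mono'[of 1 p ?P] by (intro mult_left_mono) auto
    also have "\<dots> \<le> (?W + ?C powr p) * ?P"
      using P by (intro mult_right_mono) auto
    finally show ?thesis .
  qed
qed

section \<open>Measurability on the semigroup\<close>

lemma space_borel_G: "space borel_G = G"
  by (simp add: borel_G_def space_restrict_space)

lemma measurable_borel_GI:
  assumes "f \<in> borel_measurable N" "\<And>x. x \<in> space N \<Longrightarrow> f x \<in> G"
  shows "f \<in> N \<rightarrow>\<^sub>M borel_G"
  unfolding borel_G_def using assms by (intro measurable_restrict_space2) auto

lemma measurable_borel_GD: "f \<in> N \<rightarrow>\<^sub>M borel_G \<Longrightarrow> f \<in> borel_measurable N"
  unfolding borel_G_def by (rule measurable_restrict_space2_iff[THEN iffD1, THEN conjunct1])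

lemma entry_measurable [measurable]: "(\<lambda>g. g $ i $ j) \<in> borel_measurable borel_G"
  unfolding borel_G_def
  by (intro measurable_restrict_space1 borel_measurable_continuous_onI continuous_intros)

lemma col_sum_measurable [measurable]: "(\<lambda>g. col_sum g j) \<in> borel_measurable borel_G"
  unfolding col_sum_def by measurable

lemma opnorm_l1_measurable [measurable]: "opnorm_l1 \<in> borel_measurable borel_G"
proof -
  have "(\<lambda>g. Max ((\<lambda>j. col_sum g j) ` UNIV)) \<in> borel_measurable borel_G"
    by (intro borel_measurable_Max) auto
  then show ?thesis
    by (rule measurable_cong[THEN iffD1, rotated]) (simp add: opnorm_l1_eq_Max space_borel_G)
qed

lemma v_measurable [measurable]: "v \<in> borel_measurable borel_G"
proof -
  have "(\<lambda>g. Min ((\<lambda>j. col_sum g j) ` UNIV)) \<in> borel_measurable borel_G"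
    by (intro borel_measurable_Min) auto
  then show ?thesis
    by (rule measurable_cong[THEN iffD1, rotated]) (simp add: v_eq_Min space_borel_G)
qed

lemma L_measurable [measurable]: "L \<in> borel_measurable borel_G"
  unfolding L_def[abs_def] by measurable

lemma pinched_measurable [measurable]: "Measurable.pred borel_G (pinched \<epsilon>)"
  unfolding pinched_def[abs_def] by measurable

lemma factor_measurable [measurable]: "factor \<epsilon> \<in> borel_measurable borel_G"
  unfolding factor_def[abs_def] by measurable

lemma mult_measurable [measurable (raw)]:
  assumes "f \<in> N \<rightarrow>\<^sub>M borel_G" "h \<in> N \<rightarrow>\<^sub>M borel_G"
  shows "(\<lambda>x. f x ** h x :: real ^ 'd ^ 'd) \<in> N \<rightarrow>\<^sub>M borel_G"
proof (rule measurable_borel_GI)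
  have "continuous_on UNIV (\<lambda>x :: (real ^ 'd ^ 'd) \<times> (real ^ 'd ^ 'd). fst x ** snd x)"
    unfolding matrix_matrix_mult_def by (intro continuous_intros)
  then show "(\<lambda>x. f x ** h x) \<in> borel_measurable N"
    by (rule borel_measurable_continuous_Pair[OF assms[THEN measurable_borel_GD]])
  show "f x ** h x \<in> G" if "x \<in> space N" for x
    using measurable_space[OF assms(1) that] measurable_space[OF assms(2) that]
    by (simp add: space_borel_G G_mult)
qed

text \<open>
  A block as a function of the coordinates with index in \<open>I\<close>: the recursion for \<open>A\<close> is run on the
  coordinate maps of the product space instead of the random matrices.
\<close>

lemma A_measurable_PiM:
  assumes "{s + 1..s + r} \<subseteq> I"
  shows "A (\<lambda>k y. y (s + k)) r \<in> PiM I (\<lambda>_. borel_G) \<rightarrow>\<^sub>M borel_G"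
  using assms
proof (induction r)
  case 0
  have "A (\<lambda>k y. y (s + k)) 0 = (\<lambda>_. mat 1)"
    by (simp add: fun_eq_iff)
  then show ?case
    by (simp add: space_borel_G mat_1_in_G)
next
  case (Suc r)
  then have "{s + 1..s + r} \<subseteq> I" "s + Suc r \<in> I"
    by auto
  with Suc.IH show ?case
    by (auto simp: A.simps(2)[abs_def] intro!: mult_measurable measurable_component_singleton)
qed

lemma A_restrict:
  assumes "{s + 1..s + r} \<subseteq> I"
  shows "A (\<lambda>k y. y (s + k)) r (restrict (\<lambda>i. Y i \<omega>) I) = A (\<lambda>k. Y (s + k)) r \<omega>"
  using assms
proof (induction r)
  case (Suc r)
  then have "{s + 1..s + r} \<subseteq> I" "s + Suc r \<in> I"
    by auto
  with Suc.IH show ?case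
    by simp
qed simp

section \<open>The mean contraction factor of a block\<close>

lemma G_pos_subset_pinched: "G_pos \<subseteq> (\<Union>m. {g \<in> G. pinched (1 / (real m + 2)) g})"
proof
  fix g :: "real ^ 'a ^ 'a"
  assume "g \<in> G_pos"
  then have g: "g \<in> G" "\<And>i j. 0 < g $ i $ j"
    by (auto simp: G_pos_def)
  define R where "R = range (\<lambda>(i, j, k). g $ k $ j / g $ i $ j)"
  have R: "g $ k $ j / g $ i $ j \<in> R" for i j k
    unfolding R_def by (rule range_eqI[where x = "(i, j, k)"]) simp
  obtain m where m: "Max R \<le> real m"
    using real_arch_simple by blast
  have "pinched (1 / (real m + 2)) g"
    unfolding pinched_def
  proof (intro allI conjI)
    fix i j k
    have "finite R"
      by (simp add: R_def)
    from Max_ge[OF this R[of k j i]] m have "g $ k $ j / g $ i $ j \<le> real m + 2"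
      by linarith
    then show "1 / (real m + 2) * g $ k $ j \<le> g $ i $ j"
      using g(2)[of i j] by (simp add: field_simps)
  qed (rule g(2))
  with g(1) show "g \<in> (\<Union>m. {g \<in> G. pinched (1 / (real m + 2)) g})"
    by blast
qed

lemma sets_convolution_power [simp]: "sets (convolution_power \<mu> r) = sets borel_G"
  by (cases r) (simp_all add: mult_convolution_def)

lemma space_convolution_power: "space (convolution_power \<mu> r) = G"
  using sets_eq_imp_space_eq[OF sets_convolution_power[of \<mu> r]] by (simp add: space_borel_G)

text \<open>
  As \<open>G_pos\<close> is covered by countably many sets of pinched matrices, one of these has positive
  measure under the law of a block of suitable length.
\<close>

lemma nn_integral_factor_less_1:
  fixes \<mu> :: "(real ^ 'd ^ 'd) measure"
  assumes "strictly_contracting \<mu>" and prob: "\<And>r. prob_space (convolution_power \<mu> r)"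
  obtains r \<epsilon> \<theta> where "1 \<le> r" "0 < \<epsilon>" "\<epsilon> < 1" "0 < \<theta>" "\<theta> < 1"
    "(\<integral>\<^sup>+ g. ennreal (factor \<epsilon> g) \<partial>convolution_power \<mu> r) = ennreal \<theta>"
proof -
  obtain r where r: "1 \<le> r" "0 < emeasure (convolution_power \<mu> r) G_pos"
    using assms(1) by (auto simp: strictly_contracting_def)
  define N where "N = convolution_power \<mu> r"
  interpret N: prob_space N
    unfolding N_def by (rule prob)
  define S :: "nat \<Rightarrow> (real ^ 'd ^ 'd) set" where "S m = {g \<in> G. pinched (1 / (real m + 2)) g}" for m
  have S: "S m \<in> sets N" for m
  proof -
    have "{g \<in> space borel_G. pinched (1 / (real m + 2)) g} \<in> sets borel_G"
      by measurable
    then show ?thesis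
      by (simp add: N_def S_def space_borel_G)
  qed
  have "emeasure N (\<Union>m. S m) \<noteq> 0"
    using r(2) emeasure_mono[OF G_pos_subset_pinched, of N] S
    by (auto simp: N_def S_def)
  then obtain m where m: "emeasure N (S m) \<noteq> 0"
    using emeasure_UN_eq_0[of N S] S by blast
  define \<epsilon> where "\<epsilon> = 1 / (real m + 2)"
  have \<epsilon>: "0 < \<epsilon>" "\<epsilon> < 1"
    by (auto simp: \<epsilon>_def)
  have e: "0 < \<epsilon>\<^sup>2" "\<epsilon>\<^sup>2 < 1"
    using \<epsilon> by (auto simp: power_less_one_iff)
  have pr: "0 < N.prob (S m)"
    using m by (simp add: N.emeasure_eq_measure zero_less_measure_iff)
  define \<theta> where "\<theta> = 1 - \<epsilon>\<^sup>2 * N.prob (S m)"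
  have le: "\<epsilon>\<^sup>2 * N.prob (S m) \<le> \<epsilon>\<^sup>2 * 1"
    using e by (intro mult_left_mono) auto
  have \<theta>: "0 < \<theta>"
    using e le unfolding \<theta>_def by linarith
  have \<theta>1: "\<theta> < 1"
    using mult_pos_pos[OF e(1) pr] unfolding \<theta>_def by linarith
  have int: "integrable N (indicator (S m) :: _ \<Rightarrow> real)"
    using S by (intro integrable_real_indicator) (auto simp: N.emeasure_eq_measure)
  have fac: "factor \<epsilon> g = 1 - \<epsilon>\<^sup>2 * indicator (S m) g" if "g \<in> space N" for g
    using that by (auto simp: factor_def S_def \<epsilon>_def N_def space_convolution_power)
  have "(\<integral>\<^sup>+ g. ennreal (factor \<epsilon> g) \<partial>N) = (\<integral>\<^sup>+ g. ennreal (1 - \<epsilon>\<^sup>2 * indicator (S m) g) \<partial>N)"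
    using fac by (intro nn_integral_cong) simp
  also have "\<dots> = ennreal (\<integral> g. 1 - \<epsilon>\<^sup>2 * indicator (S m) g \<partial>N)"
  proof (intro nn_integral_eq_integral AE_I2)
    show "integrable N (\<lambda>g. 1 - \<epsilon>\<^sup>2 * indicator (S m) g)"
      using int by simp
    show "0 \<le> 1 - \<epsilon>\<^sup>2 * indicator (S m) g" for g
      using e by (auto simp: indicator_def)
  qed
  also have "(\<integral> g. 1 - \<epsilon>\<^sup>2 * indicator (S m) g \<partial>N) = \<theta>"
    using S int by (subst Bochner_Integration.integral_diff) (auto simp: \<theta>_def N.prob_space)
  finally show thesis
    using that[of r \<epsilon> \<theta>] r \<epsilon> \<theta> \<theta>1 by (simp add: N_def)
qed

section \<open>Independence of the blocks\<close>

text \<open>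
  A sequence of independent random elements of \<open>G\<close> with common law \<open>\<mu>\<close>, indexed from \<open>1\<close>.
\<close>

locale random_matrix_product = prob_space M for M :: "'w measure" +
  fixes Y :: "nat \<Rightarrow> 'w \<Rightarrow> real ^ 'd ^ 'd" and \<mu> :: "(real ^ 'd ^ 'd) measure"
  assumes indep_Y: "indep_vars (\<lambda>_. borel_G) Y {1..}"
    and law_Y: "\<And>n. n \<ge> 1 \<Longrightarrow> distr M borel_G (Y n) = \<mu>"
begin

lemma Y_measurable: "1 \<le> k \<Longrightarrow> Y k \<in> M \<rightarrow>\<^sub>M borel_G"
  using indep_Y by (auto simp: indep_vars_def)

lemma Y_in_G: "\<omega> \<in> space M \<Longrightarrow> 1 \<le> k \<Longrightarrow> Y k \<omega> \<in> G"
  using measurable_space[OF Y_measurable] by (simp add: space_borel_G)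

lemma shifted_A_measurable: "A (\<lambda>k. Y (s + k)) r \<in> M \<rightarrow>\<^sub>M borel_G"
proof (induction r)
  case 0
  have "A (\<lambda>k. Y (s + k)) 0 = (\<lambda>_. mat 1)"
    by (simp add: fun_eq_iff)
  then show ?case
    by (simp add: space_borel_G mat_1_in_G)
next
  case (Suc r)
  then show ?case
    using Y_measurable[of "s + Suc r"]
    by (auto simp: A.simps(2)[abs_def] intro!: mult_measurable)
qed

lemma distr_shifted_A: "distr M borel_G (A (\<lambda>k. Y (s + k)) r) = convolution_power \<mu> r"
proof (induction r)
  case 0
  have "A (\<lambda>k. Y (s + k)) 0 = (\<lambda>_. mat 1)"
    by (simp add: fun_eq_iff)
  then show ?case
    by (simp add: space_borel_G mat_1_in_G distr_const)
next
  case (Suc r)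
  let ?I = "{s + Suc r}" and ?J = "{s + 1..s + r}" and ?B = "A (\<lambda>k. Y (s + k)) r"
  have "indep_var (PiM ?I (\<lambda>_. borel_G)) (\<lambda>\<omega>. restrict (\<lambda>i. Y i \<omega>) ?I)
      (PiM ?J (\<lambda>_. borel_G)) (\<lambda>\<omega>. restrict (\<lambda>i. Y i \<omega>) ?J)"
    by (intro indep_var_restrict[OF indep_Y]) auto
  from indep_var_compose[OF this measurable_component_singleton[of "s + Suc r" ?I]
      A_measurable_PiM[OF order_refl]]
  have "indep_var borel_G (Y (s + Suc r)) borel_G ?B"
    by (simp add: comp_def A_restrict)
  then have "distr M (borel_G \<Otimes>\<^sub>M borel_G) (\<lambda>\<omega>. (Y (s + Suc r) \<omega>, ?B \<omega>))
      = \<mu> \<Otimes>\<^sub>M convolution_power \<mu> r"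
    unfolding indep_var_distribution_eq using Suc law_Y[of "s + Suc r"] by simp
  then have "convolution_power \<mu> (Suc r) = distr (distr M (borel_G \<Otimes>\<^sub>M borel_G)
      (\<lambda>\<omega>. (Y (s + Suc r) \<omega>, ?B \<omega>))) borel_G (\<lambda>(g, h). g ** h)"
    by (simp add: mult_convolution_def)
  also have "\<dots> = distr M borel_G (A (\<lambda>k. Y (s + k)) (Suc r))"
    using Y_measurable[of "s + Suc r"] shifted_A_measurable[of s r]
    by (subst distr_distr)
       (auto simp: comp_def A.simps(2)[abs_def] case_prod_beta' intro!: mult_measurable)
  finally show ?case ..
qed

lemma prob_space_convolution_power: "prob_space (convolution_power \<mu> r)"
  using prob_space_distr[OF shifted_A_measurable[of 0 r]] by (simp only: distr_shifted_A)

text \<open>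
  The first \<open>q\<close> blocks and the matrix \<open>Y n\<close> depend on disjoint sets of indices as soon as
  \<open>q * r < n\<close>.
\<close>

lemma nn_integral_blocks:
  assumes F: "F \<in> borel_measurable borel_G" and H: "H \<in> borel_measurable borel_G"
    and n: "q * r < n"
  shows "(\<integral>\<^sup>+ \<omega>. F (Y n \<omega>) * (\<Prod>j<q. H (block Y r j \<omega>)) \<partial>M)
    = (\<integral>\<^sup>+ g. F g \<partial>\<mu>) * (\<integral>\<^sup>+ g. H g \<partial>convolution_power \<mu> r) ^ q"
proof -
  define I where "I j = (if j < q then {j * r + 1..j * r + r} else {n})" for j
  define f :: "nat \<Rightarrow> (nat \<Rightarrow> real ^ 'd ^ 'd) \<Rightarrow> ennreal" where
    "f j = (if j < q then (\<lambda>y. H (A (\<lambda>k y. y (j * r + k)) r y)) else (\<lambda>y. F (y n)))" for j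
  define X where "X j \<omega> = (if j < q then H (block Y r j \<omega>) else F (Y n \<omega>))" for j \<omega>
  have upper: "j * r + r \<le> i * r" if "j < i" for i j
    using mult_le_mono1[of "Suc j" i r] that by simp
  have disj: "I i \<inter> I j = {}" if "i < j" "j \<le> q" for i j
    using that upper[of i j] upper[of i q] n by (auto simp: I_def)
  have "indep_vars (\<lambda>j. PiM (I j) (\<lambda>_. borel_G)) (\<lambda>j \<omega>. restrict (\<lambda>i. Y i \<omega>) (I j)) {..q}"
  proof (rule indep_vars_restrict[OF indep_Y])
    show "I j \<subseteq> {1..}" for j
      using n by (auto simp: I_def)
    show "disjoint_family_on I {..q}"
      unfolding disjoint_family_on_def using disj by (metis Int_commute atMost_iff nat_neq_iff)
  qed
  moreover have "f j \<in> borel_measurable (PiM (I j) (\<lambda>_. borel_G))" for j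
    using F measurable_compose[OF A_measurable_PiM[of "j * r" r "I j"] H]
    by (auto simp: f_def I_def)
  ultimately have "indep_vars (\<lambda>_. borel) (\<lambda>j \<omega>. f j (restrict (\<lambda>i. Y i \<omega>) (I j))) {..q}"
    by (rule indep_vars_compose2)
  also have "(\<lambda>j \<omega>. f j (restrict (\<lambda>i. Y i \<omega>) (I j))) = X"
    by (auto simp: fun_eq_iff f_def I_def X_def block_def A_restrict)
  finally have "(\<integral>\<^sup>+ \<omega>. (\<Prod>j\<in>{..q}. X j \<omega>) \<partial>M) = (\<Prod>j\<in>{..q}. \<integral>\<^sup>+ \<omega>. X j \<omega> \<partial>M)"
    by (intro indep_vars_nn_integral) auto
  moreover have "(\<integral>\<^sup>+ \<omega>. H (block Y r j \<omega>) \<partial>M) = (\<integral>\<^sup>+ g. H g \<partial>convolution_power \<mu> r)" for j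
    unfolding block_def distr_shifted_A[of "j * r" r, symmetric]
    using H by (subst nn_integral_distr[OF shifted_A_measurable]) auto
  moreover have "(\<integral>\<^sup>+ \<omega>. F (Y n \<omega>) \<partial>M) = (\<integral>\<^sup>+ g. F g \<partial>\<mu>)"
  proof -
    have "1 \<le> n"
      using n by simp
    then show ?thesis
      by (subst law_Y[symmetric]) (auto intro!: nn_integral_distr[symmetric] F Y_measurable)
  qed
  ultimately show ?thesis
    by (simp add: lessThan_Suc_atMost[symmetric] X_def mult.commute)
qed

end

section \<open>Inequalities for real powers\<close>

lemma ennreal_powr_SUP_le:
  assumes "1 \<le> p" "I \<noteq> {}" and z: "\<And>n. n \<in> I \<Longrightarrow> 0 \<le> z n"
    and le: "\<And>n. n \<in> I \<Longrightarrow> ennreal (z n powr p) \<le> B"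
  shows "ennreal_powr (SUP n\<in>I. ennreal (z n)) p \<le> B"
proof (cases B)
  case (real b)
  define S where "S = (SUP n\<in>I. ennreal (z n))"
  have "z n \<le> b powr (1 / p)" if "n \<in> I" for n
  proof -
    have "z n powr p \<le> b"
      using le[OF that] real by simp
    then have "(z n powr p) powr (1 / p) \<le> b powr (1 / p)"
      using assms(1) by (intro powr_mono2) auto
    then show ?thesis
      using assms(1) z[OF that] by (simp add: powr_powr)
  qed
  then have S: "S \<le> ennreal (b powr (1 / p))"
    unfolding S_def by (auto intro!: SUP_least)
  then have "enn2real S \<le> b powr (1 / p)"
    by (intro enn2real_leI) auto
  then have "enn2real S powr p \<le> (b powr (1 / p)) powr p"
    using assms(1) by (intro powr_mono2) auto
  also have "\<dots> = b"
    using assms(1) real by (simp add: powr_powr)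
  finally have "ennreal_powr S p \<le> B"
    using S real by (auto simp: ennreal_powr_def top_unique intro!: ennreal_leI)
  then show ?thesis
    by (simp add: S_def)
qed auto

text \<open>
  Jensen's inequality for the weights \<open>b ^ k\<close>, normalised by their sum. Positivity of \<open>z\<close> keeps the
  arguments in \<open>{0<..}\<close>, where \<open>\<lambda>t. t powr p\<close> is convex. The constant does not depend on \<open>n\<close>.
\<close>

lemma sum_powr_le_weighted:
  fixes b p :: real and z :: "nat \<Rightarrow> real"
  assumes b: "0 < b" "b < 1" and p: "1 \<le> p" and z: "\<And>k. 0 < z k"
  shows "(\<Sum>k<n. z k) powr p
    \<le> (1 / (1 - b)) powr (p - 1) * (\<Sum>k<n. (b ^ k) powr (1 - p) * z k powr p)"
proof (cases "n = 0")
  case False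
  define S where "S = (\<Sum>k<n. b ^ k)"
  have S: "0 < S" "S \<le> 1 / (1 - b)"
  proof -
    show "0 < S"
      unfolding S_def using False b by (intro sum_pos) auto
    have "S \<le> (\<Sum>k. b ^ k)"
      unfolding S_def using b by (intro sum_le_suminf summable_geometric) auto
    then show "S \<le> 1 / (1 - b)"
      using b by (simp add: suminf_geometric)
  qed
  have "(\<Sum>k<n. z k) powr p = (\<Sum>k<n. (b ^ k / S) *\<^sub>R (z k * S / b ^ k)) powr p"
    using b S by simp
  also have "\<dots> \<le> (\<Sum>k<n. (b ^ k / S) * (z k * S / b ^ k) powr p)"
  proof (rule convex_on_sum[where C = "{0<..}" and f = "\<lambda>x. x powr p"])
    show "(\<Sum>k<n. b ^ k / S) = 1"
      using S by (simp add: sum_divide_distrib[symmetric] S_def)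
  qed (use False b S z p powr_convex in \<open>auto intro!: divide_nonneg_pos\<close>)
  also have "\<dots> = (\<Sum>k<n. S powr (p - 1) * ((b ^ k) powr (1 - p) * z k powr p))"
    using b S z by (intro sum.cong)
      (simp_all add: powr_mult powr_divide powr_diff less_imp_le field_simps)
  also have "\<dots> = S powr (p - 1) * (\<Sum>k<n. (b ^ k) powr (1 - p) * z k powr p)"
    by (simp add: sum_distrib_left)
  also have "\<dots> \<le> (1 / (1 - b)) powr (p - 1) * (\<Sum>k<n. (b ^ k) powr (1 - p) * z k powr p)"
    using S p by (intro mult_right_mono powr_mono2 sum_nonneg mult_nonneg_nonneg) auto
  finally show ?thesis .
qed simp

lemma power_div_le_powr:
  fixes \<theta> :: real
  assumes "0 < \<theta>" "\<theta> < 1" "1 \<le> r" "1 \<le> n"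
  shows "\<theta> ^ ((n - 1) div r) \<le> (\<theta> powr (1 / r)) ^ n / \<theta>"
proof -
  define q where "q = (n - 1) div r"
  have "n - 1 = q * r + (n - 1) mod r" "(n - 1) mod r < r"
    using assms(3) by (auto simp: q_def)
  then have "n \<le> (q + 1) * r"
    using assms(4) by simp
  then have "real n \<le> (real q + 1) * real r"
    by (metis of_nat_1 of_nat_add of_nat_le_iff of_nat_mult)
  then have "real n / real r \<le> real q + 1"
    using assms(3) by (simp add: divide_le_eq)
  then have "\<theta> powr (real q + 1) \<le> \<theta> powr (real n / real r)"
    using assms by (intro powr_mono') auto
  also have "\<dots> = (\<theta> powr (1 / r)) ^ n"
    using assms by (simp add: powr_power)
  also have "\<theta> powr (real q + 1) = \<theta> ^ q * \<theta>"
    using assms by (simp add: powr_add powr_realpow)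
  finally show ?thesis
    using assms(1) by (simp add: q_def pos_le_divide_eq)
qed

section \<open>Telescoping and the suprema over the simplex\<close>

lemma sigma_A_diff_sum:
  assumes Y: "\<And>k. k \<ge> 1 \<Longrightarrow> Y k \<omega> \<in> G" and xy: "x \<in> S_plus" "y \<in> S_plus"
  shows "\<sigma> (A Y n \<omega>) x - \<sigma> (A Y n \<omega>) y =
    (\<Sum>k<n. \<sigma> (Y (Suc k) \<omega>) (act (A Y k \<omega>) x) - \<sigma> (Y (Suc k) \<omega>) (act (A Y k \<omega>) y))"
proof (induction n)
  case 0
  show ?case
    using xy by (simp add: \<sigma>_def S_plus_def)
next
  case (Suc n)
  have "A Y n \<omega> \<in> G" "Y (Suc n) \<omega> \<in> G"
    using Y by (auto intro: A_in_G)
  with Suc xy show ?case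
    by (simp add: sigma_act)
qed

lemma SUP_sigma_diff_eq:
  fixes g :: "nat \<Rightarrow> real ^ 'd ^ 'd"
  assumes "\<And>n. n \<in> I \<Longrightarrow> g n \<in> G"
  shows "(SUP x\<in>S_plus. SUP y\<in>S_plus. SUP n\<in>I. ennreal \<bar>\<sigma> (g n) x - \<sigma> (g n) y\<bar>)
    = (SUP n\<in>I. ennreal \<bar>ln (opnorm_l1 (g n)) - ln (v (g n))\<bar>)"
proof (rule antisym)
  show "(SUP x\<in>S_plus. SUP y\<in>S_plus. SUP n\<in>I. ennreal \<bar>\<sigma> (g n) x - \<sigma> (g n) y\<bar>)
    \<le> (SUP n\<in>I. ennreal \<bar>ln (opnorm_l1 (g n)) - ln (v (g n))\<bar>)"
  proof (intro SUP_least)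
    fix x y :: "real ^ 'd" and n
    assume xy: "x \<in> S_plus" "y \<in> S_plus" and n: "n \<in> I"
    have "\<bar>\<sigma> (g n) x - \<sigma> (g n) y\<bar> \<le> \<bar>ln (opnorm_l1 (g n)) - ln (v (g n))\<bar>"
      using abs_sigma_diff_le[OF assms[OF n] xy] ln_L_eq[OF assms[OF n]] by simp
    then show "ennreal \<bar>\<sigma> (g n) x - \<sigma> (g n) y\<bar>
        \<le> (SUP n\<in>I. ennreal \<bar>ln (opnorm_l1 (g n)) - ln (v (g n))\<bar>)"
      using n by (intro SUP_upper2[of n] ennreal_leI)
  qed
  show "(SUP n\<in>I. ennreal \<bar>ln (opnorm_l1 (g n)) - ln (v (g n))\<bar>)
    \<le> (SUP x\<in>S_plus. SUP y\<in>S_plus. SUP n\<in>I. ennreal \<bar>\<sigma> (g n) x - \<sigma> (g n) y\<bar>)"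
  proof (intro SUP_least)
    fix n assume n: "n \<in> I"
    obtain x where x: "x \<in> S_plus" "norm_l1 (g n *v x) = opnorm_l1 (g n)"
      using opnorm_l1_attained[OF assms[OF n]] .
    obtain y where y: "y \<in> S_plus" "norm_l1 (g n *v y) = v (g n)"
      using v_attained[OF assms[OF n]] .
    have "ennreal \<bar>ln (opnorm_l1 (g n)) - ln (v (g n))\<bar> = ennreal \<bar>\<sigma> (g n) x - \<sigma> (g n) y\<bar>"
      by (simp add: \<sigma>_def x y)
    also have "\<dots> \<le> (SUP x\<in>S_plus. SUP y\<in>S_plus. SUP n\<in>I. ennreal \<bar>\<sigma> (g n) x - \<sigma> (g n) y\<bar>)"
      by (intro SUP_upper2[OF x(1)] SUP_upper2[OF y(1)] SUP_upper2[OF n] order_refl)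
    finally show "ennreal \<bar>ln (opnorm_l1 (g n)) - ln (v (g n))\<bar> \<le>
        (SUP x\<in>S_plus. SUP y\<in>S_plus. SUP n\<in>I. ennreal \<bar>\<sigma> (g n) x - \<sigma> (g n) y\<bar>)" .
  qed
qed

section \<open>Exponential decay and integrability\<close>

context random_matrix_product
begin

lemma delta_le_delta_tilde: "\<delta> M Y p n \<le> \<delta>_tilde M Y p n"
  unfolding \<delta>_def \<delta>_tilde_def
proof (intro SUP_least nn_integral_mono)
  fix x y :: "real ^ 'd" and \<omega>
  assume x: "x \<in> S_plus" and y: "y \<in> S_plus"
  show "ennreal (\<bar>\<sigma> (Y n \<omega>) (act (A Y (n - 1) \<omega>) x) - \<sigma> (Y n \<omega>) (act (A Y (n - 1) \<omega>) y)\<bar> powr p)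
    \<le> (SUP x\<in>S_plus. SUP y\<in>S_plus. ennreal (\<bar>\<sigma> (Y n \<omega>) (act (A Y (n - 1) \<omega>) x)
        - \<sigma> (Y n \<omega>) (act (A Y (n - 1) \<omega>) y)\<bar> powr p))"
    by (intro SUP_upper2[OF x] SUP_upper2[OF y] order_refl)
qed

text \<open>
  A positive measurable bound for the \<open>p\<close>-th power of each increment, uniform in \<open>x\<close> and \<open>y\<close>. It
  stands in for the supremum over \<open>x\<close> and \<open>y\<close>, whose measurability then plays no role.
\<close>

definition increment_majorant :: "real \<Rightarrow> (nat \<Rightarrow> 'w \<Rightarrow> real) \<Rightarrow> bool" where
  "increment_majorant p V \<longleftrightarrow> (\<forall>n\<ge>1. V n \<in> borel_measurable M \<and> (\<forall>\<omega>\<in>space M. 0 < V n \<omega> \<and>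
    (\<forall>x\<in>S_plus. \<forall>y\<in>S_plus.
      \<bar>\<sigma> (Y n \<omega>) (act (A Y (n - 1) \<omega>) x) - \<sigma> (Y n \<omega>) (act (A Y (n - 1) \<omega>) y)\<bar> powr p \<le> V n \<omega>)))"

lemma increment_majorantD:
  assumes "increment_majorant p V" "1 \<le> n"
  shows "V n \<in> borel_measurable M"
    and "\<omega> \<in> space M \<Longrightarrow> 0 < V n \<omega>"
    and "\<omega> \<in> space M \<Longrightarrow> x \<in> S_plus \<Longrightarrow> y \<in> S_plus \<Longrightarrow>
      \<bar>\<sigma> (Y n \<omega>) (act (A Y (n - 1) \<omega>) x) - \<sigma> (Y n \<omega>) (act (A Y (n - 1) \<omega>) y)\<bar> powr p \<le> V n \<omega>"
  using assms by (auto simp: increment_majorant_def)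

lemma ex_geometric_increment_majorant:
  assumes "1 \<le> p" "strictly_contracting \<mu>" "almost_admits_moment \<mu> p"
  obtains a D V where "0 < a" "a < 1" "0 \<le> D" "increment_majorant p V"
    "\<And>n. 1 \<le> n \<Longrightarrow> (\<integral>\<^sup>+ \<omega>. ennreal (V n \<omega>) \<partial>M) \<le> ennreal (D * a ^ n)"
proof -
  obtain r \<epsilon> \<theta> where r: "1 \<le> r" and \<epsilon>: "0 < \<epsilon>" "\<epsilon> < 1" and \<theta>: "0 < \<theta>" "\<theta> < 1"
    and fac: "(\<integral>\<^sup>+ g. ennreal (factor \<epsilon> g) \<partial>convolution_power \<mu> r) = ennreal \<theta>"
    using nn_integral_factor_less_1[OF assms(2) prob_space_convolution_power] .
  define C where "C = (1 / ((1 - \<epsilon>\<^sup>2) * \<epsilon> ^ 4)) powr p"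
  define F where "F g = ln (L g) powr p + C" for g :: "real ^ 'd ^ 'd"
  define q where "q n = (n - 1) div r" for n
  define P where "P n \<omega> = (\<Prod>j<q n. factor \<epsilon> (block Y r j \<omega>))" for n \<omega>
  define V where "V n \<omega> = F (Y n \<omega>) * P n \<omega>" for n \<omega>
  have e: "\<epsilon>\<^sup>2 < 1"
    using \<epsilon> by (simp add: power_less_one_iff)
  have C: "0 < C"
    using e \<epsilon> by (simp add: C_def)
  have F: "0 < F g" for g
    using C by (simp add: F_def add_nonneg_pos)
  have F_meas: "F \<in> borel_measurable borel_G"
    unfolding F_def[abs_def] by measurable
  have qr: "q n * r \<le> n - 1" for n
    by (simp add: q_def)
  have P: "0 < P n \<omega>" for n \<omega>
    unfolding P_def using factor_bounds(3)[OF \<epsilon>] by (intro prod_pos) auto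
  interpret \<mu>: prob_space \<mu>
    using prob_space_distr[OF Y_measurable[of 1]] law_Y[of 1] by simp
  have sets_\<mu>: "sets \<mu> = sets borel_G"
    using sets_distr[of M borel_G "Y 1"] unfolding law_Y[OF order_refl] .
  have [measurable]: "L \<in> borel_measurable \<mu>"
    using L_measurable measurable_cong_sets[OF sets_\<mu> refl] by blast
  have "(\<integral>\<^sup>+ g. ennreal (F g) \<partial>\<mu>) = (\<integral>\<^sup>+ g. ennreal (ln (L g) powr p) \<partial>\<mu>) + ennreal C"
    using C by (simp add: F_def nn_integral_add \<mu>.emeasure_space_1)
  also have "\<dots> < \<infinity>"
    using assms(3) by (simp add: almost_admits_moment_def ennreal_add_less_top)
  finally obtain K where K: "0 \<le> K" "(\<integral>\<^sup>+ g. ennreal (F g) \<partial>\<mu>) = ennreal K"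
    by (metis less_infinityE infinity_ennreal_def ennreal_cases less_irrefl)
  show thesis
  proof (rule that)
    show "0 < \<theta> powr (1 / r)"
      using \<theta> by simp
    show "\<theta> powr (1 / r) < 1"
      using \<theta> r powr_less_mono2[of "1 / r" \<theta> 1] by simp
    \<comment> \<open>As \<open>n / r \<le> q n + 1\<close>, counting \<open>n / r\<close> blocks instead of \<open>q n\<close> costs a factor \<open>1 / \<theta>\<close>.\<close>
    show "0 \<le> K / \<theta>"
      using K \<theta> by simp
    show "increment_majorant p V"
      unfolding increment_majorant_def
    proof (intro allI impI conjI ballI)
      show "V n \<in> borel_measurable M" if "1 \<le> n" for n
        unfolding V_def[abs_def] P_def block_def
        using measurable_compose[OF Y_measurable[OF that] F_meas]
          measurable_compose[OF shifted_A_measurable factor_measurable]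
        by (intro borel_measurable_times borel_measurable_prod)
      show "0 < V n \<omega>" for n \<omega>
        using F P by (simp add: V_def)
      show "\<bar>\<sigma> (Y n \<omega>) (act (A Y (n - 1) \<omega>) x) - \<sigma> (Y n \<omega>) (act (A Y (n - 1) \<omega>) y)\<bar> powr p \<le> V n \<omega>"
        if "1 \<le> n" "\<omega> \<in> space M" "x \<in> S_plus" "y \<in> S_plus" for n \<omega> x y
        unfolding V_def F_def C_def P_def
        by (rule sigma_increment_powr_le[OF \<epsilon> _ that(3,4) assms(1) that(1) qr]) (rule Y_in_G[OF that(2)])
    qed
    show "(\<integral>\<^sup>+ \<omega>. ennreal (V n \<omega>) \<partial>M) \<le> ennreal (K / \<theta> * (\<theta> powr (1 / r)) ^ n)" if n: "1 \<le> n" for n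
    proof -
      have "(\<integral>\<^sup>+ \<omega>. ennreal (V n \<omega>) \<partial>M)
          = (\<integral>\<^sup>+ \<omega>. ennreal (F (Y n \<omega>)) * (\<Prod>j<q n. ennreal (factor \<epsilon> (block Y r j \<omega>))) \<partial>M)"
      proof -
        have "ennreal (V n \<omega>) = ennreal (F (Y n \<omega>)) * (\<Prod>j<q n. ennreal (factor \<epsilon> (block Y r j \<omega>)))" for \<omega>
        proof -
          have "(\<Prod>j<q n. ennreal (factor \<epsilon> (block Y r j \<omega>))) = ennreal (P n \<omega>)"
            unfolding P_def by (intro prod_ennreal less_imp_le factor_bounds(3) \<epsilon>)
          then show ?thesis
            using F P by (simp add: V_def ennreal_mult less_imp_le)
        qed
        then show ?thesis
          by simp
      qed
      also have "\<dots> = ennreal K * ennreal \<theta> ^ q n"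
      proof -
        have "q n * r < n"
          using qr[of n] n by simp
        from nn_integral_blocks[OF _ _ this, of "\<lambda>g. ennreal (F g)" "\<lambda>g. ennreal (factor \<epsilon> g)"]
        show ?thesis
          using F_meas by (simp add: fac K)
      qed
      also have "\<dots> = ennreal (K * \<theta> ^ q n)"
        using K \<theta> by (simp add: ennreal_mult ennreal_power)
      also have "\<dots> \<le> ennreal (K * ((\<theta> powr (1 / r)) ^ n / \<theta>))"
        unfolding q_def using K \<theta> r n by (intro ennreal_leI mult_left_mono power_div_le_powr)
      finally show ?thesis
        by simp
    qed
  qed
qed

lemma delta_tilde_le:
  assumes "increment_majorant p V" "1 \<le> n"
  shows "\<delta>_tilde M Y p n \<le> (\<integral>\<^sup>+ \<omega>. ennreal (V n \<omega>) \<partial>M)"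
  unfolding \<delta>_tilde_def using increment_majorantD(3)[OF assms]
  by (intro nn_integral_mono SUP_least ennreal_leI)

lemma A_measurable: "A Y n \<in> M \<rightarrow>\<^sub>M borel_G"
  using shifted_A_measurable[of 0 n] by simp

text \<open>
  With \<open>b = a powr (1 / p)\<close> the weights satisfy \<open>(b ^ k) powr (1 - p) * a ^ k = b ^ k\<close>, so that the
  weighted series of the means \<open>D * a ^ k\<close> is still geometric.
\<close>

lemma in_Lp_SUP_ln_L:
  assumes p: "1 \<le> p" and a: "0 < a" "a < 1" and "0 \<le> D"
    and V: "increment_majorant p V"
    and V_le: "\<And>n. 1 \<le> n \<Longrightarrow> (\<integral>\<^sup>+ \<omega>. ennreal (V n \<omega>) \<partial>M) \<le> ennreal (D * a ^ n)"
  shows "in_Lp p M (\<lambda>\<omega>. SUP n\<in>{1..}. ennreal \<bar>ln (opnorm_l1 (A Y n \<omega>)) - ln (v (A Y n \<omega>))\<bar>)"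
proof -
  define b where "b = a powr (1 / p)"
  have b: "0 < b" "b < 1"
    using a p powr_less_mono2[of "1 / p" a 1] by (auto simp: b_def)
  have b_p: "b powr p = a"
    using a p by (simp add: b_def powr_powr)
  define c where "c = (1 / (1 - b)) powr (p - 1)"
  define w where "w k = (b ^ k) powr (1 - p)" for k :: nat
  have w_a: "w k * a ^ k = b ^ k" for k
  proof -
    have "a ^ k = (b ^ k) powr p"
      using b by (simp add: b_p[symmetric] powr_power powr_realpow[symmetric] powr_powr mult.commute)
    then show ?thesis
      using b by (simp add: w_def powr_add[symmetric])
  qed
  define B where "B \<omega> = ennreal c * (\<Sum>k. ennreal (w k) * ennreal (V (Suc k) \<omega>))" for \<omega>
  have bound: "ennreal (\<bar>ln (opnorm_l1 (A Y n \<omega>)) - ln (v (A Y n \<omega>))\<bar> powr p) \<le> B \<omega>"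
    if \<omega>: "\<omega> \<in> space M" for n \<omega>
  proof -
    define z where "z k = V (Suc k) \<omega> powr (1 / p)" for k
    have z: "0 < z k" "z k powr p = V (Suc k) \<omega>" for k
      using increment_majorantD(2)[OF V, of "Suc k" \<omega>] \<omega> p by (auto simp: z_def powr_powr)
    have AG: "A Y n \<omega> \<in> G"
      using Y_in_G[OF \<omega>] by (rule A_in_G)
    obtain x where x: "x \<in> S_plus" "norm_l1 (A Y n \<omega> *v x) = opnorm_l1 (A Y n \<omega>)"
      using opnorm_l1_attained[OF AG] .
    obtain y where y: "y \<in> S_plus" "norm_l1 (A Y n \<omega> *v y) = v (A Y n \<omega>)"
      using v_attained[OF AG] .
    define d where "d k = \<sigma> (Y (Suc k) \<omega>) (act (A Y k \<omega>) x) - \<sigma> (Y (Suc k) \<omega>) (act (A Y k \<omega>) y)" for k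
    have d: "\<bar>d k\<bar> \<le> z k" for k
    proof -
      have "\<bar>d k\<bar> powr p \<le> V (Suc k) \<omega>"
        using increment_majorantD(3)[OF V, of "Suc k" \<omega> x y] \<omega> x y by (simp add: d_def)
      then have "(\<bar>d k\<bar> powr p) powr (1 / p) \<le> z k"
        unfolding z_def using p by (intro powr_mono2) auto
      then show ?thesis
        using p by (simp add: powr_powr)
    qed
    have "\<bar>ln (opnorm_l1 (A Y n \<omega>)) - ln (v (A Y n \<omega>))\<bar> = \<bar>\<Sum>k<n. d k\<bar>"
    proof -
      have "\<sigma> (A Y n \<omega>) x - \<sigma> (A Y n \<omega>) y = (\<Sum>k<n. d k)"
        unfolding d_def by (rule sigma_A_diff_sum[OF _ x(1) y(1)]) (rule Y_in_G[OF \<omega>])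
      then show ?thesis
        by (simp add: \<sigma>_def x y)
    qed
    also have "\<dots> \<le> (\<Sum>k<n. z k)"
      using d by (intro order_trans[OF sum_abs] sum_mono)
    finally have "\<bar>ln (opnorm_l1 (A Y n \<omega>)) - ln (v (A Y n \<omega>))\<bar> powr p \<le> (\<Sum>k<n. z k) powr p"
      using p by (intro powr_mono2) auto
    also have "\<dots> \<le> c * (\<Sum>k<n. w k * V (Suc k) \<omega>)"
      using sum_powr_le_weighted[where z = z and n = n, OF b p z(1)] by (simp add: c_def w_def z(2))
    finally have "ennreal (\<bar>ln (opnorm_l1 (A Y n \<omega>)) - ln (v (A Y n \<omega>))\<bar> powr p)
        \<le> ennreal (c * (\<Sum>k<n. w k * V (Suc k) \<omega>))"
      by (rule ennreal_leI)
    also have "\<dots> = ennreal c * (\<Sum>k<n. ennreal (w k) * ennreal (V (Suc k) \<omega>))"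
      using increment_majorantD(2)[OF V _ \<omega>]
      by (simp add: c_def w_def ennreal_mult sum_nonneg less_imp_le flip: sum_ennreal)
    also have "\<dots> \<le> B \<omega>"
      unfolding B_def by (intro mult_left_mono sum_le_suminf) auto
    finally show ?thesis .
  qed
  have [measurable]: "(\<lambda>\<omega>. V (Suc k) \<omega>) \<in> borel_measurable M" for k
    using increment_majorantD(1)[OF V, of "Suc k"] by simp
  have "(\<integral>\<^sup>+ \<omega>. B \<omega> \<partial>M) = ennreal c * (\<Sum>k. ennreal (w k) * (\<integral>\<^sup>+ \<omega>. ennreal (V (Suc k) \<omega>) \<partial>M))"
    unfolding B_def by (simp add: nn_integral_cmult nn_integral_suminf)
  also have "\<dots> \<le> ennreal c * (\<Sum>k. ennreal (D * b ^ k))"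
  proof (intro mult_left_mono suminf_le)
    fix k
    have "ennreal (w k) * (\<integral>\<^sup>+ \<omega>. ennreal (V (Suc k) \<omega>) \<partial>M) \<le> ennreal (w k) * ennreal (D * a ^ Suc k)"
      using V_le[of "Suc k"] by (intro mult_left_mono) auto
    also have "\<dots> = ennreal (D * b ^ k * a)"
      unfolding w_a[symmetric] using \<open>0 \<le> D\<close> a by (simp add: w_def ac_simps flip: ennreal_mult)
    also have "\<dots> \<le> ennreal (D * b ^ k)"
      using \<open>0 \<le> D\<close> a b by (intro ennreal_leI mult_right_le_one_le) auto
    finally show "ennreal (w k) * (\<integral>\<^sup>+ \<omega>. ennreal (V (Suc k) \<omega>) \<partial>M) \<le> ennreal (D * b ^ k)" .
  qed auto
  also have "(\<Sum>k. ennreal (D * b ^ k)) = ennreal (\<Sum>k. D * b ^ k)"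
    using \<open>0 \<le> D\<close> b by (intro suminf_ennreal2 summable_mult summable_geometric) auto
  finally have fin: "(\<integral>\<^sup>+ \<omega>. B \<omega> \<partial>M) < \<infinity>"
    by (auto simp: less_top[symmetric] top_unique ennreal_mult_eq_top_iff)
  have "(\<integral>\<^sup>+ \<omega>. ennreal_powr (SUP n\<in>{1..}. ennreal \<bar>ln (opnorm_l1 (A Y n \<omega>)) - ln (v (A Y n \<omega>))\<bar>) p \<partial>M)
      \<le> (\<integral>\<^sup>+ \<omega>. B \<omega> \<partial>M)"
    using p bound by (intro nn_integral_mono ennreal_powr_SUP_le) auto
  also note fin
  finally show ?thesis
    unfolding in_Lp_def
    using measurable_compose[OF A_measurable opnorm_l1_measurable]
      measurable_compose[OF A_measurable v_measurable]
    by (auto intro!: borel_measurable_SUP measurable_compose[OF _ measurable_ennreal]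
        borel_measurable_abs borel_measurable_diff borel_measurable_ln)
qed

end

theorem proposition3p2:
  fixes \<mu> :: "(real ^ 'd ^ 'd) measure"
    and M :: "'w measure"
    and Y :: "nat \<Rightarrow> 'w \<Rightarrow> real ^ 'd ^ 'd"
    and p :: real
  assumes dim: "CARD('d) \<ge> 2"
    and mu_prob: "prob_space \<mu>"
    and mu_sets: "sets \<mu> = sets borel_G"
    and M_prob: "prob_space M"
    and Y_indep: "prob_space.indep_vars M (\<lambda>_. borel_G) Y {1..}"
    and Y_law: "\<And>n. n \<ge> 1 \<Longrightarrow> distr M borel_G (Y n) = \<mu>"
    and p: "p \<ge> 1"
    and contracting: "strictly_contracting \<mu>"
    and moment: "almost_admits_moment \<mu> p"
  shows "(\<exists>a::real. 0 < a \<and> a < 1 \<and>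
            (\<forall>n\<ge>1. \<delta> M Y p n \<le> \<delta>_tilde M Y p n \<and> \<delta>_tilde M Y p n < \<infinity>) \<and>
            (\<lambda>n. enn2real (\<delta>_tilde M Y p n)) \<in> O(\<lambda>n. a ^ n))
       \<and> in_Lp p M (\<lambda>\<omega>. SUP x\<in>S_plus. SUP y\<in>S_plus. SUP n\<in>{1..}.
            ennreal \<bar>\<sigma> (A Y n \<omega>) x - \<sigma> (A Y n \<omega>) y\<bar>)
       \<and> in_Lp p M (\<lambda>\<omega>. SUP n\<in>{1..}.
            ennreal \<bar>ln (opnorm_l1 (A Y n \<omega>)) - ln (v (A Y n \<omega>))\<bar>)"
proof -
  interpret prob_space M
    by (rule M_prob)
  interpret random_matrix_product M Y \<mu>
    by unfold_locales (fact Y_indep, fact Y_law)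
  obtain a D V where a: "0 < a" "a < 1" "0 \<le> D" and V: "increment_majorant p V"
    and V_le: "\<And>n. 1 \<le> n \<Longrightarrow> (\<integral>\<^sup>+ \<omega>. ennreal (V n \<omega>) \<partial>M) \<le> ennreal (D * a ^ n)"
    by (rule ex_geometric_increment_majorant[OF p contracting moment]) blast
  have le: "\<delta>_tilde M Y p n \<le> ennreal (D * a ^ n)" if "1 \<le> n" for n
    using delta_tilde_le[OF V that] V_le[OF that] by (rule order_trans)
  have "(\<lambda>n. enn2real (\<delta>_tilde M Y p n)) \<in> O(\<lambda>n. a ^ n)"
  proof (rule bigoI)
    show "\<forall>\<^sub>F n in sequentially. norm (enn2real (\<delta>_tilde M Y p n)) \<le> D * norm (a ^ n)"
      using eventually_ge_at_top[of 1]
    proof eventually_elim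
      case (elim n)
      have "enn2real (\<delta>_tilde M Y p n) \<le> D * a ^ n"
        using le[OF elim] a by (intro enn2real_leI) auto
      then show ?case
        using a by simp
    qed
  qed
  moreover have "\<delta>_tilde M Y p n < \<infinity>" if "1 \<le> n" for n
    using le[OF that] by (auto simp: less_top[symmetric] top_unique)
  moreover note delta_le_delta_tilde
  ultimately have 1: "\<exists>a::real. 0 < a \<and> a < 1 \<and>
      (\<forall>n\<ge>1. \<delta> M Y p n \<le> \<delta>_tilde M Y p n \<and> \<delta>_tilde M Y p n < \<infinity>) \<and>
      (\<lambda>n. enn2real (\<delta>_tilde M Y p n)) \<in> O(\<lambda>n. a ^ n)"
    using a by blast
  have 2: "in_Lp p M (\<lambda>\<omega>. SUP n\<in>{1..}. ennreal \<bar>ln (opnorm_l1 (A Y n \<omega>)) - ln (v (A Y n \<omega>))\<bar>)"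
    by (rule in_Lp_SUP_ln_L[OF p a V V_le])
  have "(SUP x\<in>S_plus. SUP y\<in>S_plus. SUP n\<in>{1..}. ennreal \<bar>\<sigma> (A Y n \<omega>) x - \<sigma> (A Y n \<omega>) y\<bar>)
      = (SUP n\<in>{1..}. ennreal \<bar>ln (opnorm_l1 (A Y n \<omega>)) - ln (v (A Y n \<omega>))\<bar>)"
    if "\<omega> \<in> space M" for \<omega>
    using Y_in_G[OF that] by (intro SUP_sigma_diff_eq A_in_G)
  with 2 have "in_Lp p M (\<lambda>\<omega>. SUP x\<in>S_plus. SUP y\<in>S_plus. SUP n\<in>{1..}.
      ennreal \<bar>\<sigma> (A Y n \<omega>) x - \<sigma> (A Y n \<omega>) y\<bar>)"
    unfolding in_Lp_def by (simp cong: measurable_cong nn_integral_cong)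
  with 1 2 show ?thesis
    by blast
qed

end
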